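(* Let $K$ be a field, let $n\geq 2$ be an integer and let $A\in\mathcal{M}_n(K)$. If $\mathrm{rank}(A)<n/2$, then, for every $X\in\mathcal{M}_n(K)$, $\det(AX+XA)=0$ and $$\mathrm{adj}(AX+XA)\, A=A\,\mathrm{adj}(AX+XA)=0_n.$$
   Context: $\mathcal{M}_n(K)$ denotes the set of $n\times n$ matrices with entries in $K$, $0_n$ is the zero $n\times n$ matrix, and $\mathrm{adj}(M)$ denotes the classical adjoint (adjugate, i.e. transpose of the cofactor matrix) of $M$. *)

theory Defs
  imports Complex_Main "Jordan_Normal_Form.Determinant" "Jordan_Normal_Form.DL_Rank"
begin

end

theory Submission
  imports Defs
begin

text \<open>
  A rank factorization \<open>A = P * Q\<close> with \<open>r\<close> inner columns yields
  \<open>A * X + X * A = [P | X * P] * [Q * X; Q]\<close>, so all columns of \<open>A * X + X * A\<close> and of \<open>A\<close>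
  lie in the span of the \<open>2 * r < n\<close> columns of \<open>[P | X * P]\<close>. By Cramer's rule, every entry of
  \<open>adj (A * X + X * A) * A\<close> is the determinant of a matrix with columns in that span, hence
  vanishes. The product in the other order is handled by transposition.
\<close>

text \<open>A maximal independent set \<open>U\<close> of columns has \<open>rank A\<close> elements
  and, by maximality, spans every column. The elements of \<open>U\<close> become the columns of
  \<open>P\<close>, and the coordinates of the columns of \<open>A\<close> with respect to them
  become the columns of \<open>Q\<close>.\<close>

lemma (in vec_space) rank_factorization:
  assumes A: "A \<in> carrier_mat n nc"
  obtains P Q where "P \<in> carrier_mat n (rank A)" "Q \<in> carrier_mat (rank A) nc" "A = P * Q"
proof -
  let ?indpt = "\<lambda>T. T \<subseteq> set (cols A) \<and> lin_indpt T"
  have cols: "set (cols A) \<subseteq> carrier_vec n" using A cols_dim by blast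
  have "?indpt {}" by (simp add: lin_dep_def)
  then obtain U where U: "maximal U ?indpt"
    using maximal_exists_superset[of "set (cols A)" ?indpt "{}"] by auto
  then have sub: "U \<subseteq> set (cols A)" and indpt: "lin_indpt U" by (auto simp: maximal_def)
  have Uc: "U \<subseteq> carrier_vec n" and fin: "finite U" using sub cols finite_subset by auto
  have card: "card U = rank A" using rank_card_indpt[OF A U] by simp
  have in_U: "s \<in> span U" if s: "s \<in> set (cols A)" for s
  proof (rule ccontr)
    assume ns: "s \<notin> span U"
    then have "s \<notin> U" using Uc span_mem by auto
    moreover have "lin_indpt (U \<union> {s})"
      using lin_dep_iff_in_span[of U s] Uc indpt ns s cols \<open>s \<notin> U\<close> by auto
    ultimately show False using U s sub unfolding maximal_def by blast
  qed
  obtain us where us: "set us = U" "distinct us" using finite_distinct_list[OF fin] by blast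
  have len: "length us = rank A" using us card distinct_card by fastforce
  define P where "P = mat_of_cols n us"
  have P: "P \<in> carrier_mat n (rank A)" unfolding P_def using mat_of_cols_carrier(1)[of n us] len by simp
  have colsP: "cols P = us" unfolding P_def using us Uc by simp
  have "\<exists>v \<in> carrier_vec (rank A). P *\<^sub>v v = s" if s: "s \<in> set (cols A)" for s
  proof -
    obtain a where "s = lincomb a U"
      using in_U[OF s] finite_in_span[OF fin, of s] Uc by auto
    \<comment> \<open>Listing the coefficients in the order of the columns of \<open>P\<close> turns
      the linear combination into a product; since \<open>us\<close> is distinct, each element of
      \<open>U\<close> is counted once.\<close>
    then have "P *\<^sub>v vec (rank A) (\<lambda>i. a (col P i)) = s"
      using mat_mult_eq_lincomb[OF P, of a] colsP us by auto
    then show ?thesis by (intro bexI) auto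
  qed
  then obtain f where f: "f s \<in> carrier_vec (rank A)" "P *\<^sub>v f s = s"
    if "s \<in> set (cols A)" for s by metis
  define Q where "Q = mat_of_cols (rank A) (map f (cols A))"
  have Q: "Q \<in> carrier_mat (rank A) nc" unfolding Q_def using A by auto
  have "A = P * Q"
  proof (rule mat_col_eqI)
    fix j assume "j < dim_col (P * Q)"
    then have j: "j < nc" using Q by simp
    then have "col A j \<in> set (cols A)" using A by (auto simp: cols_def)
    moreover have "col Q j = f (col A j)"
      unfolding Q_def using j A f(1)[OF \<open>col A j \<in> set (cols A)\<close>] by (subst col_mat_of_cols) auto
    ultimately show "col A j = col (P * Q) j" using f(2) col_mult2[OF P Q j] by metis
  qed (use A P Q in auto)
  with P Q show thesis by (rule that)
qed

text \<open>Padding \<open>U\<close> with zero columns and \<open>V\<close> with zero rows makes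
  both square without changing the product, and the padded \<open>U\<close> has determinant
  zero.\<close>

lemma det_mult_inner_less:
  fixes U V :: "'a :: comm_ring_1 mat"
  assumes U: "U \<in> carrier_mat n m" and V: "V \<in> carrier_mat m n" and "m < n"
  shows "det (U * V) = 0"
proof -
  define U' where "U' = mat n n (\<lambda>(i,j). if j < m then U $$ (i,j) else 0)"
  define V' where "V' = mat n n (\<lambda>(i,j). if i < m then V $$ (i,j) else 0)"
  have U': "U' \<in> carrier_mat n n" and V': "V' \<in> carrier_mat n n"
    by (auto simp: U'_def V'_def)
  have "U * V = U' * V'"
  proof (rule eq_matI)
    fix i j assume "i < dim_row (U' * V')" "j < dim_col (U' * V')"
    then have ij: "i < n" "j < n" using U' V' by auto
    have "(\<Sum>k = 0..<m. U $$ (i,k) * V $$ (k,j)) = (\<Sum>k = 0..<n. U' $$ (i,k) * V' $$ (k,j))"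
      using ij \<open>m < n\<close> by (intro sum.mono_neutral_cong_left) (auto simp: U'_def V'_def)
    then show "(U * V) $$ (i,j) = (U' * V') $$ (i,j)"
      using ij U V U' V' by (simp add: scalar_prod_def)
  qed (use U V U' V' in auto)
  moreover have "det U' = 0"
    \<comment> \<open>As \<open>m \<le> n - 1\<close>, the last column of \<open>U'\<close> is zero,
      so each term of the expansion along it vanishes.\<close>
    using \<open>m < n\<close> by (subst laplace_expansion_column[OF U', of "n - 1"]) (auto simp: U'_def)
  ultimately show ?thesis using det_mult[OF U' V'] by simp
qed

text \<open>Cramer's rule in division-free form: expand the determinant along column
  \<open>k\<close>, whose cofactors do not see the replaced entries.\<close>

lemma adj_mat_mult_vec_index:
  assumes M: "M \<in> carrier_mat n n" and b: "b \<in> carrier_vec n" and k: "k < n"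
  shows "(adj_mat M *\<^sub>v b) $ k = det (replace_col M b k)"
proof -
  have R: "replace_col M b k \<in> carrier_mat n n" using M by (auto simp: replace_col_def)
  have "mat_delete (replace_col M b k) i k = mat_delete M i k" for i
    using M by (intro eq_matI) (auto simp: mat_delete_def replace_col_def)
  then have cof: "cofactor (replace_col M b k) i k = cofactor M i k" for i
    by (simp add: cofactor_def)
  have "det (replace_col M b k) = (\<Sum>i<n. replace_col M b k $$ (i,k) * cofactor M i k)"
    using laplace_expansion_column[OF R k] cof by simp
  also have "\<dots> = (\<Sum>i = 0..<n. cofactor M i k * b $ i)"
    unfolding atLeast0LessThan using M k
    by (intro sum.cong) (auto simp: replace_col_def mult.commute)
  also have "\<dots> = (adj_mat M *\<^sub>v b) $ k"
    using M b k by (simp add: adj_mat_def scalar_prod_def)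
  finally show ?thesis by simp
qed

text \<open>By Cramer's rule each entry is the determinant of \<open>U * V\<close> with one column
  replaced by a column of \<open>U * W\<close>. The replacement can be carried out inside the right
  factor, so the new matrix still factors through dimension \<open>m < n\<close>.\<close>

lemma adj_mat_mult_low_rank:
  fixes U V W :: "'a :: comm_ring_1 mat"
  assumes U: "U \<in> carrier_mat n m" and V: "V \<in> carrier_mat m n" and W: "W \<in> carrier_mat m n"
    and "m < n"
  shows "adj_mat (U * V) * (U * W) = 0\<^sub>m n n"
proof (rule eq_matI)
  have M: "U * V \<in> carrier_mat n n" and B: "U * W \<in> carrier_mat n n" using U V W by auto
  note adj = adj_mat(1)[OF M]
  fix k j assume "k < dim_row (0\<^sub>m n n :: 'a mat)" "j < dim_col (0\<^sub>m n n :: 'a mat)"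
  then have kj: "k < n" "j < n" by auto
  have "(adj_mat (U * V) * (U * W)) $$ (k,j) = (adj_mat (U * V) *\<^sub>v col (U * W) j) $ k"
    using kj adj U W by auto
  also have "\<dots> = det (replace_col (U * V) (col (U * W) j) k)"
    using adj_mat_mult_vec_index[OF M _ kj(1)] kj B by simp
  also have "replace_col (U * V) (col (U * W) j) k = U * replace_col V (col W j) k"
  proof (rule mat_col_eqI)
    have R: "replace_col V (col W j) k \<in> carrier_mat m n" using V by (auto simp: replace_col_def)
    fix l assume "l < dim_col (U * replace_col V (col W j) k)"
    then have l: "l < n" using R by simp
    have "col (replace_col V (col W j) k) l = (if l = k then col W j else col V l)"
      using l V W kj by (intro eq_vecI) (auto simp: replace_col_def)
    moreover have "col (replace_col (U * V) (col (U * W) j) k) l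
        = (if l = k then col (U * W) j else col (U * V) l)"
      using l U V W kj by (intro eq_vecI) (auto simp: replace_col_def)
    ultimately show "col (replace_col (U * V) (col (U * W) j) k) l
        = col (U * replace_col V (col W j) k) l"
      using col_mult2[OF U R l] col_mult2[OF U V l] col_mult2[OF U W kj(2)] by metis
  qed (use U V W in \<open>auto simp: replace_col_def\<close>)
  also have "det (U * replace_col V (col W j) k) = 0"
    using V \<open>m < n\<close> by (intro det_mult_inner_less[OF U]) (auto simp: replace_col_def)
  finally show "(adj_mat (U * V) * (U * W)) $$ (k,j) = 0\<^sub>m n n $$ (k,j)" using kj by simp
qed (use U V W in \<open>auto simp: adj_mat_def\<close>)

text \<open>Transposition exchanges the two deleted indices, and the cofactor sign is symmetric in
  them. This reduces \<open>A * adj_mat M\<close> to a product in the other order.\<close>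

lemma adj_mat_transpose:
  fixes M :: "'a :: comm_ring_1 mat"
  assumes M: "M \<in> carrier_mat n n"
  shows "adj_mat M\<^sup>T = (adj_mat M)\<^sup>T"
proof (rule eq_matI)
  fix i j assume "i < dim_row (adj_mat M)\<^sup>T" "j < dim_col (adj_mat M)\<^sup>T"
  then have ij: "i < n" "j < n" using M by (auto simp: adj_mat_def)
  have "mat_delete M\<^sup>T j i = (mat_delete M i j)\<^sup>T"
    using M ij by (intro eq_matI) (auto simp: mat_delete_def)
  moreover have "mat_delete M i j \<in> carrier_mat (n - 1) (n - 1)"
    using M by (auto simp: mat_delete_def)
  ultimately have "cofactor M\<^sup>T j i = cofactor M i j"
    by (simp add: cofactor_def det_transpose add.commute)
  then show "adj_mat M\<^sup>T $$ (i,j) = (adj_mat M)\<^sup>T $$ (i,j)"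
    using ij M by (simp add: adj_mat_def)
qed (use M in \<open>auto simp: adj_mat_def\<close>)

text \<open>Phrased through a factorization instead of the rank, so that it applies both to
  \<open>A\<close> and to its transpose.\<close>

lemma det_adj_mat_anticommutator:
  fixes P Q X :: "'a :: comm_ring_1 mat"
  assumes P: "P \<in> carrier_mat n r" and Q: "Q \<in> carrier_mat r n" and X: "X \<in> carrier_mat n n"
    and r: "2 * r < n"
  defines "M \<equiv> (P * Q) * X + X * (P * Q)"
  shows "det M = 0" and "adj_mat M * (P * Q) = 0\<^sub>m n n"
proof -
  \<comment> \<open>In block form \<open>U = [P | X * P]\<close>, \<open>V = [Q * X; Q]\<close> and
    \<open>W = [Q; 0]\<close>; the blocks with no rows or no columns only fill up the four arguments
    of \<open>four_block_mat\<close>. \<open>W\<close> is chosen to select \<open>P\<close> from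
    \<open>U\<close>, giving \<open>U * W = P * Q\<close>.\<close>
  define U where "U = four_block_mat P (X * P) (0\<^sub>m 0 r) (0\<^sub>m 0 r)"
  define V where "V = four_block_mat (Q * X) (0\<^sub>m r 0) Q (0\<^sub>m r 0)"
  define W where "W = four_block_mat Q (0\<^sub>m r 0) (0\<^sub>m r n) (0\<^sub>m r 0)"
  have U: "U \<in> carrier_mat n (2 * r)" and V: "V \<in> carrier_mat (2 * r) n"
    and W: "W \<in> carrier_mat (2 * r) n"
    unfolding U_def V_def W_def using P Q X by (auto simp: mult_2)
  have "U * V = four_block_mat (P * (Q * X) + (X * P) * Q) (0\<^sub>m n 0) (0\<^sub>m 0 n) (0\<^sub>m 0 0)"
    unfolding U_def V_def using P Q X
    by (subst mult_four_block_mat[of _ n r _ r _ 0]) auto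
  also have "P * (Q * X) + (X * P) * Q = M"
    unfolding M_def using P Q X by (simp add: assoc_mult_mat[of _ n r _ n _ n] assoc_mult_mat[of _ n n _ r _ n])
  also have "four_block_mat M (0\<^sub>m n 0) (0\<^sub>m 0 n) (0\<^sub>m 0 0) = M"
    unfolding M_def using P Q X by (intro eq_matI) auto
  finally have M: "U * V = M" .
  have "U * W = four_block_mat (P * Q) (0\<^sub>m n 0) (0\<^sub>m 0 n) (0\<^sub>m 0 0)"
    unfolding U_def W_def using P Q X
    by (subst mult_four_block_mat[of _ n r _ r _ 0]) auto
  also have "\<dots> = P * Q" using P Q by (intro eq_matI) auto
  finally have A: "U * W = P * Q" .
  show "det M = 0" using det_mult_inner_less[OF U V r] M by simp
  show "adj_mat M * (P * Q) = 0\<^sub>m n n" using adj_mat_mult_low_rank[OF U V W r] M A by simp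
qed

theorem lemma1:
  fixes A :: "'k::field mat" and n :: nat
  assumes "n \<ge> 2"
    and "A \<in> carrier_mat n n"
    and "real (vec_space.rank n A) < real n / 2"
  shows "\<forall>X \<in> carrier_mat n n.
           det (A * X + X * A) = 0 \<and>
           adj_mat (A * X + X * A) * A = 0\<^sub>m n n \<and>
           A * adj_mat (A * X + X * A) = 0\<^sub>m n n"
proof
  fix X :: "'k mat"
  assume X: "X \<in> carrier_mat n n"
  note A = assms(2)
  define M where "M = A * X + X * A"
  have M: "M \<in> carrier_mat n n" using A X by (simp add: M_def)
  note adj = adj_mat(1)[OF M]
  obtain P Q where P: "P \<in> carrier_mat n (vec_space.rank n A)"
    and Q: "Q \<in> carrier_mat (vec_space.rank n A) n" and PQ: "A = P * Q"
    using vec_space.rank_factorization[OF A] by blast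
  have r: "2 * vec_space.rank n A < n" using assms(3) by linarith
  have 1: "det M = 0" "adj_mat M * A = 0\<^sub>m n n"
    using det_adj_mat_anticommutator[OF P Q X r] unfolding M_def PQ by auto
  \<comment> \<open>The transposed factorization has the same inner dimension, so the bound
    \<open>r\<close> carries over to \<open>A\<^sup>T\<close>, and \<open>M\<^sup>T\<close> has the
    same shape as \<open>M\<close>, built from \<open>A\<^sup>T\<close> and
    \<open>X\<^sup>T\<close>.\<close>
  have AT: "A\<^sup>T = Q\<^sup>T * P\<^sup>T" using transpose_mult[OF P Q] PQ by simp
  have "M\<^sup>T = A\<^sup>T * X\<^sup>T + X\<^sup>T * A\<^sup>T"
    unfolding M_def using A X transpose_mult[OF A X] transpose_mult[OF X A]
    by (simp add: transpose_add[of _ n n] comm_add_mat[of _ n n])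
  then have "adj_mat M\<^sup>T * A\<^sup>T = 0\<^sub>m n n"
    using det_adj_mat_anticommutator(2)[of "Q\<^sup>T" n _ "P\<^sup>T" "X\<^sup>T"] P Q X r AT by simp
  then have "(A * adj_mat M)\<^sup>T = 0\<^sub>m n n"
    using adj_mat_transpose[OF M] transpose_mult[OF A adj] by simp
  then have "A * adj_mat M = 0\<^sub>m n n"
    by (metis transpose_transpose zero_transpose_mat)
  with 1 show "det (A * X + X * A) = 0 \<and> adj_mat (A * X + X * A) * A = 0\<^sub>m n n \<and>
      A * adj_mat (A * X + X * A) = 0\<^sub>m n n"
    unfolding M_def by simp
qed

end
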